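(* Let $\mathcal{G}$ be a connected groupoid with finite object set $\mathcal{G}_0$ and let $\alpha=(A_g,\alpha_g)_{g\in\mathcal{G}}$ be a unital group-type partial action of $\mathcal{G}$ on a ring $A=\bigoplus_{y\in\mathcal{G}_0}A_y$. If $\mathcal{G}$ is finite then $A\subset A\star_\alpha\mathcal{G}$ is a Frobenius extension.
   Context: Rings are associative, not necessarily unital. A groupoid is a small category in which every morphism is invertible; for $g:x\to y$ write $s(g)=x$, $t(g)=y$; objects are identified with their identity morphisms; $gh$ is defined iff $s(g)=t(h)$. $\mathcal{G}$ is connected if any two objects are joined by a morphism. A partial action of $\mathcal{G}$ on a ring $A$ is a family $\alpha=(A_g,\alpha_g)_{g\in\mathcal{G}}$ such that: (i) $A_g$ is an ideal of $A_{t(g)}$ and $A_{t(g)}$ is an ideal of $A$ for all $g$; (ii) $\alpha_g:A_{g^{-1}}\to A_g$ is a ring isomorphism; (iii) $\alpha_y=\mathrm{id}_{A_y}$ for each object $y$; (iv) $\alpha_{gh}$ extends $\alpha_g\alpha_h$ (defined on $\alpha_h^{-1}(A_{g^{-1}}\cap A_h)$) whenever $s(g)=t(h)$. It is unital if for each $g$ there is a central idempotent $1_g$ of $A$ with $A_g=A1_g$. A transversal for an object $x$ is a family $\{\tau_y\}_{y\in\mathcal{G}_0}$ of morphisms $\tau_y:x\to y$ with $\tau_x=x$. A partial action $\alpha$ of a connected groupoid is group-type if for some object $x$ there is a transversal $\{\tau_y\}$ for $x$ with $A_{\tau_y^{-1}}=A_x$ and $A_{\tau_y}=A_y$ for all $y\in\mathcal{G}_0$.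 For a unital partial action, the partial skew groupoid ring $A\star_\alpha\mathcal{G}$ is the set of finite formal sums $\sum_g a_g\delta_g$, $a_g\in A_g$, with componentwise addition and $(a_g\delta_g)(a_h\delta_h)=a_g\alpha_g(a_h1_{g^{-1}})\delta_{gh}$ if $s(g)=t(h)$ and $0$ otherwise. When $\mathcal{G}_0$ is finite it has identity $\sum_{y\in\mathcal{G}_0}1_y\delta_y$ and is a ring extension of $A$ via $a\mapsto\sum_{y\in\mathcal{G}_0}(a1_y)\delta_y$. A unital ring extension $R\subset S$ is Frobenius if there exist an element $\Delta=\sum_{i=1}^n s_{i1}\otimes s_{i2}\in S\otimes_R S$ and an $R$-bimodule map $\varepsilon:S\to R$ such that $\Delta s=s\Delta$ for all $s\in S$ and $\sum_{i=1}^n\varepsilon(s_{i1})s_{i2}=\sum_{i=1}^n s_{i1}\varepsilon(s_{i2})=1$. *)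

theory Defs
  imports "HOL-Algebra.Free_Abelian_Groups" "HOL-Algebra.Generated_Groups" "HOL-Algebra.Ring"
begin

section \<open>Groupoids\<close>

text \<open>
  A small category is presented by its set of morphisms; an object is identified with its
  identity morphism, so \<open>src\<close> and \<open>tgt\<close> return morphisms.  The composite
  \<open>cmp G g h\<close> (first \<open>h\<close>, then \<open>g\<close>) is meaningful only when \<open>src G g = tgt G h\<close>.
\<close>

record 'g category_data =
  mor :: "'g set"
  src :: "'g \<Rightarrow> 'g"
  tgt :: "'g \<Rightarrow> 'g"
  cmp :: "'g \<Rightarrow> 'g \<Rightarrow> 'g"

definition objects :: "('g, 'm) category_data_scheme \<Rightarrow> 'g set" where
  "objects G = {x \<in> mor G. src G x = x}"

locale small_category =
  fixes G :: "('g, 'm) category_data_scheme"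
  assumes src_object: "g \<in> mor G \<Longrightarrow> src G g \<in> objects G"
    and tgt_object: "g \<in> mor G \<Longrightarrow> tgt G g \<in> objects G"
    and object_tgt: "x \<in> objects G \<Longrightarrow> tgt G x = x"
    and cmp_closed: "\<lbrakk>g \<in> mor G; h \<in> mor G; src G g = tgt G h\<rbrakk> \<Longrightarrow> cmp G g h \<in> mor G"
    and src_cmp: "\<lbrakk>g \<in> mor G; h \<in> mor G; src G g = tgt G h\<rbrakk> \<Longrightarrow> src G (cmp G g h) = src G h"
    and tgt_cmp: "\<lbrakk>g \<in> mor G; h \<in> mor G; src G g = tgt G h\<rbrakk> \<Longrightarrow> tgt G (cmp G g h) = tgt G g"
    and cmp_assoc: "\<lbrakk>g \<in> mor G; h \<in> mor G; k \<in> mor G; src G g = tgt G h; src G h = tgt G k\<rbrakk>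
        \<Longrightarrow> cmp G (cmp G g h) k = cmp G g (cmp G h k)"
    and cmp_src: "g \<in> mor G \<Longrightarrow> cmp G g (src G g) = g"
    and cmp_tgt: "g \<in> mor G \<Longrightarrow> cmp G (tgt G g) g = g"

definition is_inverse :: "('g, 'm) category_data_scheme \<Rightarrow> 'g \<Rightarrow> 'g \<Rightarrow> bool" where
  "is_inverse G g h \<longleftrightarrow> h \<in> mor G \<and> src G h = tgt G g \<and> tgt G h = src G g
     \<and> cmp G h g = src G g \<and> cmp G g h = tgt G g"

definition ginv :: "('g, 'm) category_data_scheme \<Rightarrow> 'g \<Rightarrow> 'g" where
  "ginv G g = (THE h. is_inverse G g h)"

locale groupoid = small_category +
  assumes invertible: "g \<in> mor G \<Longrightarrow> \<exists>h. is_inverse G g h"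

locale connected_groupoid = groupoid +
  assumes connected: "\<lbrakk>x \<in> objects G; y \<in> objects G\<rbrakk>
    \<Longrightarrow> \<exists>g\<in>mor G. src G g = x \<and> tgt G g = y"


section \<open>Partial actions of groupoids on rings\<close>

text \<open>
  The ring \<open>A\<close> is the type \<open>'a\<close> of class \<open>ring\<close> (associative, no unit is assumed).
\<close>

definition ideal_in :: "'a::ring set \<Rightarrow> 'a set \<Rightarrow> bool" where
  "ideal_in I J \<longleftrightarrow> I \<subseteq> J \<and> 0 \<in> I \<and> (\<forall>a\<in>I. \<forall>b\<in>I. a - b \<in> I)
     \<and> (\<forall>a\<in>I. \<forall>r\<in>J. r * a \<in> I \<and> a * r \<in> I)"

definition ring_iso_on :: "'a::ring set \<Rightarrow> 'a set \<Rightarrow> ('a \<Rightarrow> 'a) \<Rightarrow> bool" where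
  "ring_iso_on I J f \<longleftrightarrow> bij_betw f I J
     \<and> (\<forall>a\<in>I. \<forall>b\<in>I. f (a + b) = f a + f b \<and> f (a * b) = f a * f b)"

text \<open>
  \<open>D g\<close> is the ideal \<open>A\<^sub>g\<close>; the values of \<open>\<alpha> g\<close> outside \<open>D (ginv G g)\<close> are irrelevant.
\<close>

locale partial_action = groupoid G
  for G :: "('g, 'm) category_data_scheme" +
  fixes D :: "'g \<Rightarrow> 'a::ring set" and \<alpha> :: "'g \<Rightarrow> 'a \<Rightarrow> 'a"
  assumes ideal_tgt: "g \<in> mor G \<Longrightarrow> ideal_in (D g) (D (tgt G g))"
    and tgt_ideal: "g \<in> mor G \<Longrightarrow> ideal_in (D (tgt G g)) UNIV"
    and action_iso: "g \<in> mor G \<Longrightarrow> ring_iso_on (D (ginv G g)) (D g) (\<alpha> g)"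
    and action_object: "\<lbrakk>y \<in> objects G; a \<in> D y\<rbrakk> \<Longrightarrow> \<alpha> y a = a"
    and action_cmp: "\<lbrakk>g \<in> mor G; h \<in> mor G; src G g = tgt G h;
          a \<in> D (ginv G h); \<alpha> h a \<in> D (ginv G g) \<inter> D h\<rbrakk>
        \<Longrightarrow> a \<in> D (ginv G (cmp G g h)) \<and> \<alpha> (cmp G g h) a = \<alpha> g (\<alpha> h a)"

definition generating_idempotent :: "'a::ring set \<Rightarrow> 'a \<Rightarrow> bool" where
  "generating_idempotent I e \<longleftrightarrow> e * e = e \<and> (\<forall>a. a * e = e * a) \<and> I = range (\<lambda>a. a * e)"

text \<open>
  A central idempotent generating a given ideal is unique, being the identity of that ideal;
  \<open>unit_of (D g)\<close> is the element \<open>1\<^sub>g\<close>.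
\<close>

definition unit_of :: "'a::ring set \<Rightarrow> 'a" where
  "unit_of I = (THE e. generating_idempotent I e)"

locale unital_partial_action = partial_action +
  assumes unital: "g \<in> mor G \<Longrightarrow> \<exists>e. generating_idempotent (D g) e"

definition transversal :: "('g, 'm) category_data_scheme \<Rightarrow> 'g \<Rightarrow> ('g \<Rightarrow> 'g) \<Rightarrow> bool" where
  "transversal G x \<tau> \<longleftrightarrow>
     (\<forall>y\<in>objects G. \<tau> y \<in> mor G \<and> src G (\<tau> y) = x \<and> tgt G (\<tau> y) = y) \<and> \<tau> x = x"

definition group_type :: "('g, 'm) category_data_scheme \<Rightarrow> ('g \<Rightarrow> 'a::ring set) \<Rightarrow> bool" where
  "group_type G D \<longleftrightarrow> (\<exists>x\<in>objects G. \<exists>\<tau>. transversal G x \<tau>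
     \<and> (\<forall>y\<in>objects G. D (ginv G (\<tau> y)) = D x \<and> D (\<tau> y) = D y))"

text \<open>Internal direct sum over a finite index set, for a family of additive subgroups.\<close>

definition is_direct_sum :: "'i set \<Rightarrow> ('i \<Rightarrow> 'a::ring set) \<Rightarrow> bool" where
  "is_direct_sum I D \<longleftrightarrow> finite I \<and> bij_betw (\<lambda>f. \<Sum>i\<in>I. f i) (\<Pi>\<^sub>E i\<in>I. D i) UNIV"


section \<open>The partial skew groupoid ring\<close>

text \<open>
  A formal sum \<open>\<Sum> a\<^sub>g \<delta>\<^sub>g\<close> is a finitely supported function, and \<open>a \<delta>\<^sub>g\<close> is
  \<open>Poly_Mapping.single g a\<close>.
\<close>

definition skew_mult :: "('g, 'm) category_data_scheme \<Rightarrow> ('g \<Rightarrow> 'a::ring set) \<Rightarrow>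
    ('g \<Rightarrow> 'a \<Rightarrow> 'a) \<Rightarrow> ('g \<Rightarrow>\<^sub>0 'a) \<Rightarrow> ('g \<Rightarrow>\<^sub>0 'a) \<Rightarrow> ('g \<Rightarrow>\<^sub>0 'a)" where
  "skew_mult G D \<alpha> p q =
     (\<Sum>g\<in>Poly_Mapping.keys p. \<Sum>h\<in>Poly_Mapping.keys q.
        if src G g = tgt G h
        then Poly_Mapping.single (cmp G g h)
               (Poly_Mapping.lookup p g *
                \<alpha> g (Poly_Mapping.lookup q h * unit_of (D (ginv G g))))
        else 0)"

text \<open>The field \<open>one\<close> below is an identity only when there are finitely many objects.\<close>

definition skew_groupoid_ring :: "('g, 'm) category_data_scheme \<Rightarrow> ('g \<Rightarrow> 'a::ring set) \<Rightarrow>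
    ('g \<Rightarrow> 'a \<Rightarrow> 'a) \<Rightarrow> ('g \<Rightarrow>\<^sub>0 'a) ring" where
  "skew_groupoid_ring G D \<alpha> =
     \<lparr>carrier = {p. Poly_Mapping.keys p \<subseteq> mor G \<and> (\<forall>g\<in>mor G. Poly_Mapping.lookup p g \<in> D g)},
      monoid.mult = skew_mult G D \<alpha>,
      one = (\<Sum>y\<in>objects G. Poly_Mapping.single y (unit_of (D y))),
      ring.zero = 0,
      add = (+)\<rparr>"

definition skew_embedding :: "('g, 'm) category_data_scheme \<Rightarrow> ('g \<Rightarrow> 'a::ring set) \<Rightarrow>
    'a \<Rightarrow> ('g \<Rightarrow>\<^sub>0 'a)" where
  "skew_embedding G D a = (\<Sum>y\<in>objects G. Poly_Mapping.single y (a * unit_of (D y)))"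

text \<open>
  The ring \<open>A\<close> as a record.  Its identity, when \<open>A\<close> is the direct sum of the finitely many
  \<open>A\<^sub>y\<close>, is the sum of the \<open>1\<^sub>y\<close>.
\<close>

definition base_ring :: "('g, 'm) category_data_scheme \<Rightarrow> ('g \<Rightarrow> 'a::ring set) \<Rightarrow> 'a ring" where
  "base_ring G D =
     \<lparr>carrier = UNIV, monoid.mult = (*), one = (\<Sum>y\<in>objects G. unit_of (D y)),
      ring.zero = 0, add = (+)\<rparr>"


section \<open>Frobenius extensions\<close>

text \<open>A ring extension \<open>R \<subset> S\<close> is given by an injective unital homomorphism \<open>\<phi>\<close>.\<close>

definition ring_extension ::
    "('r, 'm) ring_scheme \<Rightarrow> ('s, 'n) ring_scheme \<Rightarrow> ('r \<Rightarrow> 's) \<Rightarrow> bool" where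
  "ring_extension R S \<phi> \<longleftrightarrow>
     Ring.ring R \<and> Ring.ring S \<and> \<phi> \<in> ring_hom R S \<and> inj_on \<phi> (carrier R)"

text \<open>
  \<open>S \<otimes>\<^sub>R S\<close> is the free abelian group on pairs modulo the subgroup generated by the usual
  relations.  As a quotient in the multiplicative group language it has the addition of
  tensors as its \<open>mult\<close>, so that sums of tensors are \<open>finprod\<close>s.
\<close>

definition tensor_relations ::
    "('r, 'm) ring_scheme \<Rightarrow> ('s, 'n) ring_scheme \<Rightarrow> ('r \<Rightarrow> 's) \<Rightarrow> ('s \<times> 's \<Rightarrow>\<^sub>0 int) set" where
  "tensor_relations R S \<phi> =
     {frag_of (x \<oplus>\<^bsub>S\<^esub> x', y) - frag_of (x, y) - frag_of (x', y) | x x' y.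
        x \<in> carrier S \<and> x' \<in> carrier S \<and> y \<in> carrier S}
   \<union> {frag_of (x, y \<oplus>\<^bsub>S\<^esub> y') - frag_of (x, y) - frag_of (x, y') | x y y'.
        x \<in> carrier S \<and> y \<in> carrier S \<and> y' \<in> carrier S}
   \<union> {frag_of (x \<otimes>\<^bsub>S\<^esub> \<phi> r, y) - frag_of (x, \<phi> r \<otimes>\<^bsub>S\<^esub> y) | x r y.
        x \<in> carrier S \<and> r \<in> carrier R \<and> y \<in> carrier S}"

definition tensor_kernel ::
    "('r, 'm) ring_scheme \<Rightarrow> ('s, 'n) ring_scheme \<Rightarrow> ('r \<Rightarrow> 's) \<Rightarrow> ('s \<times> 's \<Rightarrow>\<^sub>0 int) set" where
  "tensor_kernel R S \<phi> =
     generate (free_Abelian_group (carrier S \<times> carrier S)) (tensor_relations R S \<phi>)"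

definition tensor_square ::
    "('r, 'm) ring_scheme \<Rightarrow> ('s, 'n) ring_scheme \<Rightarrow> ('r \<Rightarrow> 's) \<Rightarrow> ('s \<times> 's \<Rightarrow>\<^sub>0 int) set monoid" where
  "tensor_square R S \<phi> =
     free_Abelian_group (carrier S \<times> carrier S) Mod tensor_kernel R S \<phi>"

definition pure_tensor ::
    "('r, 'm) ring_scheme \<Rightarrow> ('s, 'n) ring_scheme \<Rightarrow> ('r \<Rightarrow> 's) \<Rightarrow> 's \<Rightarrow> 's \<Rightarrow> ('s \<times> 's \<Rightarrow>\<^sub>0 int) set" where
  "pure_tensor R S \<phi> x y =
     tensor_kernel R S \<phi> #>\<^bsub>free_Abelian_group (carrier S \<times> carrier S)\<^esub> frag_of (x, y)"

definition bimodule_map ::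
    "('r, 'm) ring_scheme \<Rightarrow> ('s, 'n) ring_scheme \<Rightarrow> ('r \<Rightarrow> 's) \<Rightarrow> ('s \<Rightarrow> 'r) \<Rightarrow> bool" where
  "bimodule_map R S \<phi> \<epsilon> \<longleftrightarrow> \<epsilon> \<in> carrier S \<rightarrow> carrier R
     \<and> (\<forall>x\<in>carrier S. \<forall>y\<in>carrier S. \<epsilon> (x \<oplus>\<^bsub>S\<^esub> y) = \<epsilon> x \<oplus>\<^bsub>R\<^esub> \<epsilon> y)
     \<and> (\<forall>r\<in>carrier R. \<forall>x\<in>carrier S.
          \<epsilon> (\<phi> r \<otimes>\<^bsub>S\<^esub> x) = r \<otimes>\<^bsub>R\<^esub> \<epsilon> x \<and> \<epsilon> (x \<otimes>\<^bsub>S\<^esub> \<phi> r) = \<epsilon> x \<otimes>\<^bsub>R\<^esub> r)"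

text \<open>
  With \<open>\<Delta>\<close> the sum of the pure tensors \<open>u i \<otimes> v i\<close>, the first condition is
  \<open>\<Delta> s = s \<Delta>\<close>: the bimodule structure is \<open>s (x \<otimes> y) = (s x) \<otimes> y\<close>, \<open>(x \<otimes> y) s = x \<otimes> (y s)\<close>.
\<close>

definition frobenius_extension ::
    "('r, 'm) ring_scheme \<Rightarrow> ('s, 'n) ring_scheme \<Rightarrow> ('r \<Rightarrow> 's) \<Rightarrow> bool" where
  "frobenius_extension R S \<phi> \<longleftrightarrow> ring_extension R S \<phi> \<and>
     (\<exists>(n::nat) u v \<epsilon>.
        u \<in> {..<n} \<rightarrow> carrier S \<and> v \<in> {..<n} \<rightarrow> carrier S \<and> bimodule_map R S \<phi> \<epsilon>
        \<and> (\<forall>s\<in>carrier S.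
             (\<Otimes>\<^bsub>tensor_square R S \<phi>\<^esub>i\<in>{..<n}. pure_tensor R S \<phi> (u i) (v i \<otimes>\<^bsub>S\<^esub> s))
           = (\<Otimes>\<^bsub>tensor_square R S \<phi>\<^esub>i\<in>{..<n}. pure_tensor R S \<phi> (s \<otimes>\<^bsub>S\<^esub> u i) (v i)))
        \<and> (\<Oplus>\<^bsub>S\<^esub>i\<in>{..<n}. \<phi> (\<epsilon> (u i)) \<otimes>\<^bsub>S\<^esub> v i) = \<one>\<^bsub>S\<^esub>
        \<and> (\<Oplus>\<^bsub>S\<^esub>i\<in>{..<n}. u i \<otimes>\<^bsub>S\<^esub> \<phi> (\<epsilon> (v i))) = \<one>\<^bsub>S\<^esub>)"

end

theory Submission
  imports Defs
begin

text \<open>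
  Let \<open>act g a\<close> be \<open>\<alpha> g\<close> applied to \<open>a\<close> times the unit of the domain of \<open>\<alpha> g\<close>.  Then
  \<open>act g (act h a) = act (g h) a * 1\<^sub>g\<close>, which makes the skew groupoid ring associative.
  The Frobenius form sends \<open>\<Sum> a\<^sub>g \<delta>\<^sub>g\<close> to the sum of the \<open>a\<^sub>y\<close> over the objects \<open>y\<close>, and, writing
  \<open>g'\<close> for the inverse of \<open>g\<close>, \<open>\<Delta>\<close> is the sum of all \<open>1\<^sub>g \<delta>\<^sub>g \<otimes> 1\<^sub>g\<^sub>' \<delta>\<^sub>g\<^sub>'\<close>.
  For \<open>s = a \<delta>\<^sub>h\<close> the term of \<open>\<Delta> s\<close> at \<open>g = h k\<close> equals the term of \<open>s \<Delta>\<close> at \<open>k\<close>, because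
  \<open>act g' a\<close> may be moved across the tensor sign; all other terms vanish.
\<close>

section \<open>Groupoids\<close>

context groupoid
begin

lemma objectD: "y \<in> objects G \<Longrightarrow> y \<in> mor G \<and> src G y = y \<and> tgt G y = y"
  using object_tgt by (auto simp: objects_def)

lemma objects_subset_mor: "objects G \<subseteq> mor G"
  by (auto simp: objects_def)

lemma is_inverse_unique:
  assumes "g \<in> mor G" "is_inverse G g h" "is_inverse G g k"
  shows "h = k"
proof -
  have "h = cmp G h (cmp G g k)"
    using assms cmp_src[of h] by (simp add: is_inverse_def)
  also have "\<dots> = cmp G (cmp G h g) k"
    using assms cmp_assoc[of h g k] by (simp add: is_inverse_def)
  also have "\<dots> = k"
    using assms cmp_tgt[of k] by (simp add: is_inverse_def)
  finally show ?thesis .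
qed

lemma ginv_is_inverse: "g \<in> mor G \<Longrightarrow> is_inverse G g (ginv G g)"
  unfolding ginv_def by (metis invertible is_inverse_unique theI)

lemma ginv_eqI: "g \<in> mor G \<Longrightarrow> is_inverse G g h \<Longrightarrow> ginv G g = h"
  using ginv_is_inverse is_inverse_unique by blast

lemma ginv_simps [simp]:
  assumes "g \<in> mor G"
  shows "ginv G g \<in> mor G" "src G (ginv G g) = tgt G g" "tgt G (ginv G g) = src G g"
    "cmp G (ginv G g) g = src G g" "cmp G g (ginv G g) = tgt G g"
  using ginv_is_inverse[OF assms] by (auto simp: is_inverse_def)

lemma ginv_ginv [simp]: "g \<in> mor G \<Longrightarrow> ginv G (ginv G g) = g"
  by (rule ginv_eqI) (auto simp: is_inverse_def)

lemma ginv_object [simp]: "y \<in> objects G \<Longrightarrow> ginv G y = y"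
  using objectD cmp_src by (intro ginv_eqI) (fastforce simp: is_inverse_def)+

lemma cmp_ginv_cmp:
  assumes "g \<in> mor G" "h \<in> mor G" "src G g = tgt G h"
  shows "cmp G (ginv G g) (cmp G g h) = h"
  using assms cmp_assoc[of "ginv G g" g h] cmp_tgt[of h] by simp

lemma cmp_cmp_ginv:
  assumes "g \<in> mor G" "h \<in> mor G" "tgt G g = tgt G h"
  shows "cmp G g (cmp G (ginv G g) h) = h"
  using assms cmp_assoc[of g "ginv G g" h] cmp_tgt[of h] by simp

lemma ginv_cmp:
  assumes gh: "g \<in> mor G" "h \<in> mor G" "src G g = tgt G h"
  shows "ginv G (cmp G g h) = cmp G (ginv G h) (ginv G g)"
proof (rule ginv_eqI)
  show "cmp G g h \<in> mor G" using gh by (rule cmp_closed)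
  have "cmp G (cmp G (ginv G h) (ginv G g)) (cmp G g h) = src G h"
    using gh cmp_assoc[of "ginv G h" "ginv G g" "cmp G g h"] cmp_ginv_cmp[of g h]
    by (simp add: cmp_closed tgt_cmp)
  moreover have "cmp G (cmp G g h) (cmp G (ginv G h) (ginv G g)) = tgt G g"
    using gh cmp_assoc[of g h "cmp G (ginv G h) (ginv G g)"] cmp_cmp_ginv[of h "ginv G g"]
    by (simp add: cmp_closed tgt_cmp)
  ultimately show "is_inverse G (cmp G g h) (cmp G (ginv G h) (ginv G g))"
    using gh by (simp add: is_inverse_def cmp_closed src_cmp tgt_cmp)
qed

text \<open>Translation by \<open>h\<close> is undone by translation by \<open>ginv G h\<close>.
  This bijection later matches the surviving terms of \<Delta> s with those of s \<Delta>.\<close>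

lemma bij_betw_cmp_left:
  assumes "h \<in> mor G"
  shows "bij_betw (cmp G h) {g \<in> mor G. tgt G g = src G h} {g \<in> mor G. tgt G g = tgt G h}"
proof (rule bij_betw_byWitness[where f' = "cmp G (ginv G h)"])
  show "\<forall>g\<in>{g \<in> mor G. tgt G g = src G h}. cmp G (ginv G h) (cmp G h g) = g"
    using assms by (simp add: cmp_ginv_cmp)
  show "\<forall>g\<in>{g \<in> mor G. tgt G g = tgt G h}. cmp G h (cmp G (ginv G h) g) = g"
    using assms by (simp add: cmp_cmp_ginv)
qed (use assms in \<open>auto simp: cmp_closed tgt_cmp\<close>)

end

section \<open>Unital partial actions\<close>

text \<open>Both idempotents lie in \<open>I\<close> and act on it as identities, so their product
  equals each of them. This makes the definite description in \<open>unit_of\<close>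
  meaningful.\<close>

lemma generating_idempotent_unique:
  assumes "generating_idempotent I e" "generating_idempotent I e'"
  shows "e = e'"
proof -
  have id: "a * f = a" if "generating_idempotent I f" "a \<in> I" for a f
    using that unfolding generating_idempotent_def by (metis (no_types, lifting) imageE mult.assoc)
  have mem: "f \<in> I" if "generating_idempotent I f" for f
    using that by (metis generating_idempotent_def rangeI)
  have "e = e * e'" using id[OF assms(2) mem[OF assms(1)]] by simp
  also have "\<dots> = e' * e" using assms(2) by (simp add: generating_idempotent_def)
  also have "\<dots> = e'" using id[OF assms(1) mem[OF assms(2)]] .
  finally show ?thesis .
qed

lemma generating_idempotent_unit_of:
  assumes "generating_idempotent I e"
  shows "generating_idempotent I (unit_of I)"
  unfolding unit_of_def using assms generating_idempotent_unique by (metis theI)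

context unital_partial_action
begin

abbreviation idem where "idem g \<equiv> unit_of (D g)"

text \<open>Multiplying by the unit first gives a map on the whole ring, so additivity and
  multiplicativity hold without any domain condition on the argument.\<close>

definition act where "act g a = \<alpha> g (a * idem (ginv G g))"

section \<open>The ideals and their units\<close>

lemma idem_generating: "g \<in> mor G \<Longrightarrow> generating_idempotent (D g) (idem g)"
  using unital generating_idempotent_unit_of by blast

lemma idem_central: "g \<in> mor G \<Longrightarrow> a * idem g = idem g * a"
  using idem_generating[of g] unfolding generating_idempotent_def by blast

lemma idem_idem: "g \<in> mor G \<Longrightarrow> idem g * idem g = idem g"
  using idem_generating[of g] unfolding generating_idempotent_def by blast

lemma idem_left_idem: "g \<in> mor G \<Longrightarrow> idem g * (idem g * a) = idem g * a"
  by (simp add: mult.assoc[symmetric] idem_idem)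

text \<open>Membership becomes an equation, which reduces the closure properties of the ideals to
  ring arithmetic with a central idempotent.\<close>

lemma mem_D_iff:
  assumes "g \<in> mor G"
  shows "a \<in> D g \<longleftrightarrow> a * idem g = a"
proof
  assume "a \<in> D g"
  then obtain b where "a = b * idem g"
    using idem_generating[OF assms] unfolding generating_idempotent_def by blast
  then show "a * idem g = a" by (simp add: mult.assoc idem_idem assms)
next
  assume "a * idem g = a"
  then show "a \<in> D g"
    using idem_generating[OF assms] unfolding generating_idempotent_def by (metis rangeI)
qed

lemma idem_mem: "g \<in> mor G \<Longrightarrow> idem g \<in> D g"
  by (simp add: mem_D_iff idem_idem)

lemma mult_idem: "g \<in> mor G \<Longrightarrow> a \<in> D g \<Longrightarrow> a * idem g = a"
  by (simp add: mem_D_iff)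

lemma idem_mult: "g \<in> mor G \<Longrightarrow> a \<in> D g \<Longrightarrow> idem g * a = a"
  by (metis mem_D_iff idem_central)

lemma D_zero: "g \<in> mor G \<Longrightarrow> 0 \<in> D g"
  by (simp add: mem_D_iff)

lemma D_add: "g \<in> mor G \<Longrightarrow> a \<in> D g \<Longrightarrow> b \<in> D g \<Longrightarrow> a + b \<in> D g"
  by (simp add: mem_D_iff distrib_right)

lemma D_uminus: "g \<in> mor G \<Longrightarrow> a \<in> D g \<Longrightarrow> - a \<in> D g"
  by (simp add: mem_D_iff)

lemma D_mult_left: "g \<in> mor G \<Longrightarrow> a \<in> D g \<Longrightarrow> r * a \<in> D g"
  by (simp add: mem_D_iff mult.assoc)

lemma D_mult_right: "g \<in> mor G \<Longrightarrow> a \<in> D g \<Longrightarrow> a * r \<in> D g"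
  using idem_central[of g r] by (simp add: mem_D_iff mult.assoc) (simp add: mult.assoc[symmetric])

lemma D_subset_tgt: "g \<in> mor G \<Longrightarrow> a \<in> D g \<Longrightarrow> a \<in> D (tgt G g)"
  using ideal_tgt[of g] unfolding ideal_in_def by blast

section \<open>The partial isomorphisms and their composites\<close>

lemma action_mem: "g \<in> mor G \<Longrightarrow> a \<in> D (ginv G g) \<Longrightarrow> \<alpha> g a \<in> D g"
  using action_iso[of g] by (auto simp: ring_iso_on_def bij_betw_def)

lemma action_add:
  "g \<in> mor G \<Longrightarrow> a \<in> D (ginv G g) \<Longrightarrow> b \<in> D (ginv G g) \<Longrightarrow> \<alpha> g (a + b) = \<alpha> g a + \<alpha> g b"
  using action_iso[of g] by (auto simp: ring_iso_on_def)

lemma action_mult: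
  "g \<in> mor G \<Longrightarrow> a \<in> D (ginv G g) \<Longrightarrow> b \<in> D (ginv G g) \<Longrightarrow> \<alpha> g (a * b) = \<alpha> g a * \<alpha> g b"
  using action_iso[of g] by (auto simp: ring_iso_on_def)

text \<open>The composite of the two maps is extended by the map at the object
  \<open>src G g\<close>, which is the identity on its ideal.\<close>

lemma action_ginv:
  assumes g: "g \<in> mor G" and a: "a \<in> D (ginv G g)"
  shows "\<alpha> (ginv G g) (\<alpha> g a) = a"
proof -
  have "\<alpha> (src G g) a = \<alpha> (ginv G g) (\<alpha> g a)"
    using action_cmp[of "ginv G g" g a] g a action_mem by simp
  moreover have "a \<in> D (src G g)"
    using D_subset_tgt[of "ginv G g" a] g a by simp
  ultimately show ?thesis
    using action_object[OF src_object[OF g]] by simp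
qed

text \<open>Write \<open>a\<close> as the image under \<open>\<alpha> h\<close> of some
  \<open>b\<close>. Then \<open>\<alpha> g a\<close> is the value of
  \<open>\<alpha> (cmp G g h)\<close> at \<open>b\<close>, so it lies in the range of that
  map.\<close>

lemma action_mem_cmp:
  assumes g: "g \<in> mor G" and h: "h \<in> mor G" "src G g = tgt G h"
    and a: "a \<in> D (ginv G g)" "a \<in> D h"
  shows "\<alpha> g a \<in> D (cmp G g h)"
proof -
  let ?b = "\<alpha> (ginv G h) a"
  have b: "?b \<in> D (ginv G h)" "\<alpha> h ?b = a"
    using action_mem[of "ginv G h" a] action_ginv[of "ginv G h" a] h a by simp_all
  then have "?b \<in> D (ginv G (cmp G g h)) \<and> \<alpha> (cmp G g h) ?b = \<alpha> g a"
    using action_cmp[of g h ?b] g h a by simp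
  then show ?thesis
    using action_mem[of "cmp G g h" ?b] g h cmp_closed by auto
qed

text \<open>The isomorphism \<alpha> g carries the intersection of \<open>D (ginv G g)\<close> and
  \<open>D h\<close> onto that of \<open>D g\<close> and \<open>D (cmp G g h)\<close>, and so takes
  the unit \<open>?i\<close> of the first to the unit \<open>?y\<close> of the second.\<close>

lemma action_idem:
  assumes g: "g \<in> mor G" and h: "h \<in> mor G" "src G g = tgt G h"
  shows "\<alpha> g (idem (ginv G g) * idem h) = idem g * idem (cmp G g h)"
proof -
  let ?k = "cmp G g h"
  let ?i = "idem (ginv G g) * idem h" and ?y = "idem g * idem ?k"
  let ?z = "\<alpha> (ginv G g) ?y"
  have k: "?k \<in> mor G" "tgt G ?k = tgt G g" using g h by (simp_all add: cmp_closed tgt_cmp)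
  have i: "?i \<in> D (ginv G g)" "?i \<in> D h"
    using g h by (simp_all add: D_mult_left D_mult_right idem_mem)
  have y: "?y \<in> D g" "?y \<in> D ?k"
    using g k by (simp_all add: D_mult_left D_mult_right idem_mem)
  \<comment> \<open>The preimage \<open>?z\<close> lies in \<open>D h\<close> because composing
    \<open>ginv G g\<close> with \<open>?k\<close> gives back \<open>h\<close>.\<close>
  have z: "?z \<in> D (ginv G g)" "?z \<in> D h" "\<alpha> g ?z = ?y"
    using action_mem[of "ginv G g" ?y] action_mem_cmp[of "ginv G g" ?k ?y]
      action_ginv[of "ginv G g" ?y] g h k y cmp_ginv_cmp[of g h] by simp_all
  have "\<alpha> g ?i * ?y = \<alpha> g (?i * ?z)"
    using action_mult[OF g i(1) z(1)] z(3) by simp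
  also have "?i * ?z = ?z"
    using idem_mult[of "ginv G g" ?z] idem_mult[of h ?z] g h z by (simp add: mult.assoc)
  finally have "\<alpha> g ?i * ?y = ?y" using z(3) by simp
  \<comment> \<open>The image of \<open>?i\<close> lies in both ideals, so each factor of
    \<open>?y\<close> fixes it.\<close>
  moreover have "\<alpha> g ?i * ?y = \<alpha> g ?i"
    using mult_idem[OF g action_mem[OF g i(1)]] mult_idem[OF k(1) action_mem_cmp[OF g h i]]
    by (simp add: mult.assoc[symmetric])
  ultimately show ?thesis by simp
qed

section \<open>The maps extended to the whole ring\<close>

lemma mult_idem_ginv_mem: "g \<in> mor G \<Longrightarrow> a * idem (ginv G g) \<in> D (ginv G g)"
  by (simp add: D_mult_left idem_mem)

lemma act_mem: "g \<in> mor G \<Longrightarrow> act g a \<in> D g"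
  by (simp add: act_def action_mem mult_idem_ginv_mem)

lemma act_add: "g \<in> mor G \<Longrightarrow> act g (a + b) = act g a + act g b"
  by (simp add: act_def distrib_right action_add mult_idem_ginv_mem)

lemma act_zero: "g \<in> mor G \<Longrightarrow> act g 0 = 0"
  using act_add[of g 0 0] by simp

text \<open>Since the unit is central and idempotent, one copy of it can be shared out to both
  factors, which puts each of them in the domain of \<alpha> g.\<close>

lemma act_mult:
  assumes "g \<in> mor G"
  shows "act g (a * b) = act g a * act g b"
proof -
  let ?e = "idem (ginv G g)"
  have "?e * (b * ?e) = b * ?e"
    using assms idem_central[of "ginv G g" b] by (simp add: idem_left_idem)
  then have "a * b * ?e = (a * ?e) * (b * ?e)"
    by (simp add: mult.assoc)
  then show ?thesis
    using assms by (simp add: act_def action_mult mult_idem_ginv_mem)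
qed

lemma act_object: "y \<in> objects G \<Longrightarrow> act y a = a * idem y"
  using objectD[of y] by (simp add: act_def action_object D_mult_left idem_mem)

lemma act_mem_cmp:
  assumes "g \<in> mor G" "h \<in> mor G" "src G g = tgt G h" "a \<in> D h"
  shows "act g a \<in> D (cmp G g h)"
  unfolding act_def using assms
  by (intro action_mem_cmp) (simp_all add: mult_idem_ginv_mem D_mult_right)

lemma act_idem:
  assumes "g \<in> mor G" "h \<in> mor G" "src G g = tgt G h"
  shows "act g (idem h) = idem g * idem (cmp G g h)"
  using assms action_idem[of g h] idem_central[of h "idem (ginv G g)"] by (simp add: act_def)

text \<open>Both sides are the value of \<open>\<alpha> (cmp G g h)\<close> at
  \<open>a * ?c\<close>, where \<open>?c\<close> is the unit of the domain on which the two maps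
  compose. The factor \<open>idem g\<close> remains because \<open>\<alpha> (cmp G g h)\<close>
  sends \<open>?c\<close> to \<open>idem (cmp G g h) * idem g\<close>.\<close>

lemma act_act:
  assumes g: "g \<in> mor G" and h: "h \<in> mor G" "src G g = tgt G h"
  shows "act g (act h a) = act (cmp G g h) a * idem g"
proof -
  let ?k = "cmp G g h"
  let ?c = "idem (ginv G h) * idem (ginv G ?k)"
  have k: "?k \<in> mor G" "tgt G ?k = tgt G g" "src G ?k = src G h"
    using g h by (simp_all add: cmp_closed tgt_cmp src_cmp)
  have hk: "cmp G h (ginv G ?k) = ginv G g"
    using g h cmp_cmp_ginv[of h "ginv G g"] by (simp add: ginv_cmp)
  have kh: "cmp G ?k (ginv G h) = g"
    using g h cmp_assoc[of g h "ginv G h"] cmp_src[of g] by simp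
  have c: "\<alpha> h ?c = idem h * idem (ginv G g)"
    using action_idem[of h "ginv G ?k"] h k hk by simp
  have c_mem: "?c \<in> D (ginv G h)" "?c \<in> D (ginv G ?k)"
    using h k by (simp_all add: D_mult_left D_mult_right idem_mem)
  \<comment> \<open>The same element is factored in two ways, once inside the domain of \<alpha> h
    and once inside that of \<open>\<alpha> ?k\<close>, so that multiplicativity of either map
    applies.\<close>
  have ac: "a * ?c = a * idem (ginv G h) * ?c"
    using h by (simp add: mult.assoc idem_left_idem)
  have ac': "a * ?c = a * idem (ginv G ?k) * ?c"
    using k idem_idem[of "ginv G ?k"] idem_central[of "ginv G ?k" "idem (ginv G h)"]
    by (simp add: mult.assoc) (simp add: mult.assoc[symmetric])
  have "\<alpha> h (a * ?c) = act h a * (idem h * idem (ginv G g))"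
    unfolding ac using h c_mem c by (simp add: action_mult mult_idem_ginv_mem act_def)
  then have s1: "\<alpha> h (a * ?c) = act h a * idem (ginv G g)"
    using h by (simp add: mult.assoc[symmetric] mult_idem act_mem)
  have "\<alpha> ?k (a * ?c) = \<alpha> g (\<alpha> h (a * ?c))"
    using action_cmp[of g h "a * ?c"] g h c_mem s1
    by (simp add: D_mult_left D_mult_right idem_mem act_mem)
  also have "\<dots> = act g (act h a)"
    unfolding s1 by (simp add: act_def)
  finally have "act g (act h a) = \<alpha> ?k (a * ?c)" ..
  also have "\<dots> = act ?k a * \<alpha> ?k ?c"
    unfolding ac' using k c_mem by (simp add: action_mult mult_idem_ginv_mem act_def)
  also have "\<alpha> ?k ?c = idem ?k * idem g"
    using action_idem[of ?k "ginv G h"] k h kh idem_central[of "ginv G h" "idem (ginv G ?k)"] by simp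
  finally show ?thesis
    using k by (simp add: mult.assoc[symmetric] mult_idem act_mem)
qed

end

section \<open>Tensors over a ring extension\<close>

locale extension_tensor =
  fixes R :: "('r, 'm) ring_scheme" and S :: "('s, 'n) ring_scheme" and \<phi> :: "'r \<Rightarrow> 's"
  assumes extension: "ring_extension R S \<phi>"
begin

abbreviation "F \<equiv> free_Abelian_group (carrier S \<times> carrier S)"
abbreviation "K \<equiv> tensor_kernel R S \<phi>"
abbreviation "T \<equiv> tensor_square R S \<phi>"
abbreviation "pure \<equiv> pure_tensor R S \<phi>"

lemma ring_S: "Ring.ring S"
  using extension by (simp add: ring_extension_def)

lemma embedding_closed: "r \<in> carrier R \<Longrightarrow> \<phi> r \<in> carrier S"
  using extension by (auto simp: ring_extension_def ring_hom_def)

text \<open>Needed for the generated set \<open>K\<close> to be a subgroup of the free abelian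
  group.\<close>

lemma tensor_relations_subset: "tensor_relations R S \<phi> \<subseteq> carrier F"
proof -
  interpret S: Ring.ring S by (rule ring_S)
  have "frag_of p - frag_of q - frag_of r \<in> carrier F"
    if "p \<in> carrier S \<times> carrier S" "q \<in> carrier S \<times> carrier S" "r \<in> carrier S \<times> carrier S" for p q r
    using that by (auto dest!: subsetD[OF keys_diff] split: if_splits)
  moreover have "frag_of p - frag_of q \<in> carrier F"
    if "p \<in> carrier S \<times> carrier S" "q \<in> carrier S \<times> carrier S" for p q
    using that by (auto dest!: subsetD[OF keys_diff] split: if_splits)
  ultimately show ?thesis
    unfolding tensor_relations_def
    by (intro subsetI, elim UnE CollectE exE conjE)
       (simp_all only: mem_Times_iff fst_conv snd_conv S.a_closed S.m_closed embedding_closed simp_thms)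
qed

lemma comm_group_F: "comm_group F"
  by (rule abelian_free_Abelian_group)

lemma subgroup_K: "subgroup K F"
  unfolding tensor_kernel_def
  by (rule group.generate_is_subgroup[OF group_free_Abelian_group tensor_relations_subset])

lemma normal_K: "K \<lhd> F"
  by (rule comm_group.subgroup_imp_normal[OF comm_group_F subgroup_K])

lemma comm_group_T: "comm_group T"
  unfolding tensor_square_def by (rule comm_group.abelian_FactGroup[OF comm_group_F subgroup_K])

lemma coset_eqI:
  assumes "a - b \<in> K" "b \<in> carrier F"
  shows "K #>\<^bsub>F\<^esub> a = K #>\<^bsub>F\<^esub> b"
proof -
  have "a \<in> K #>\<^bsub>F\<^esub> b"
    unfolding r_coset_def using assms(1) by (auto intro!: bexI[of _ "a - b"])
  then show ?thesis
    using group.repr_independence[OF group_free_Abelian_group _ assms(2) subgroup_K] by blast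
qed

lemma frag_closed: "x \<in> carrier S \<Longrightarrow> y \<in> carrier S \<Longrightarrow> frag_of (x, y) \<in> carrier F"
  by simp

lemma pure_closed: "x \<in> carrier S \<Longrightarrow> y \<in> carrier S \<Longrightarrow> pure x y \<in> carrier T"
  unfolding pure_tensor_def tensor_square_def carrier_FactGroup by (rule imageI) simp

lemma pure_mult:
  assumes "x \<in> carrier S" "y \<in> carrier S" "x' \<in> carrier S" "y' \<in> carrier S"
  shows "pure x y \<otimes>\<^bsub>T\<^esub> pure x' y' = K #>\<^bsub>F\<^esub> (frag_of (x, y) + frag_of (x', y'))"
  using normal.rcos_sum[OF normal_K, of "frag_of (x, y)" "frag_of (x', y')"] assms
  by (simp add: pure_tensor_def tensor_square_def)

lemma sum_frag_closed:
  assumes "x \<in> carrier S" "y \<in> carrier S" "x' \<in> carrier S" "y' \<in> carrier S"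
  shows "frag_of (x, y) + frag_of (x', y') \<in> carrier F"
  using assms group.is_monoid[OF group_free_Abelian_group[of "carrier S \<times> carrier S"]]
    monoid.m_closed[of F "frag_of (x, y)" "frag_of (x', y')"] by simp

text \<open>The difference of the two representatives is a generator of \<open>K\<close>. Rewriting
  with \<open>diff_diff_eq\<close> gives it the form required by \<open>coset_eqI\<close>.\<close>

lemma pure_add_left:
  assumes "x \<in> carrier S" "x' \<in> carrier S" "y \<in> carrier S"
  shows "pure (x \<oplus>\<^bsub>S\<^esub> x') y = pure x y \<otimes>\<^bsub>T\<^esub> pure x' y"
proof -
  have "frag_of (x \<oplus>\<^bsub>S\<^esub> x', y) - frag_of (x, y) - frag_of (x', y) \<in> K"
    unfolding tensor_kernel_def tensor_relations_def
    by (rule generate.incl, rule UnI1, rule UnI1) (use assms in blast)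
  then show ?thesis
    unfolding pure_mult[OF assms(1,3,2,3)] unfolding pure_tensor_def
    using assms by (intro coset_eqI sum_frag_closed) (simp_all add: diff_diff_eq)
qed

lemma pure_add_right:
  assumes "x \<in> carrier S" "y \<in> carrier S" "y' \<in> carrier S"
  shows "pure x (y \<oplus>\<^bsub>S\<^esub> y') = pure x y \<otimes>\<^bsub>T\<^esub> pure x y'"
proof -
  have "frag_of (x, y \<oplus>\<^bsub>S\<^esub> y') - frag_of (x, y) - frag_of (x, y') \<in> K"
    unfolding tensor_kernel_def tensor_relations_def
    by (rule generate.incl, rule UnI1, rule UnI2) (use assms in blast)
  then show ?thesis
    unfolding pure_mult[OF assms(1,2,1,3)] unfolding pure_tensor_def
    using assms by (intro coset_eqI sum_frag_closed) (simp_all add: diff_diff_eq)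
qed

lemma pure_balanced:
  assumes "x \<in> carrier S" "r \<in> carrier R" "y \<in> carrier S"
  shows "pure (x \<otimes>\<^bsub>S\<^esub> \<phi> r) y = pure x (\<phi> r \<otimes>\<^bsub>S\<^esub> y)"
proof -
  interpret S: Ring.ring S by (rule ring_S)
  have "frag_of (x \<otimes>\<^bsub>S\<^esub> \<phi> r, y) - frag_of (x, \<phi> r \<otimes>\<^bsub>S\<^esub> y) \<in> K"
    unfolding tensor_kernel_def tensor_relations_def
    by (rule generate.incl, rule UnI2) (use assms in blast)
  then show ?thesis
    unfolding pure_tensor_def
    using assms embedding_closed by (intro coset_eqI frag_closed) simp_all
qed

text \<open>By additivity this tensor equals its own double, so it is the neutral element of the
  group \<open>T\<close>.\<close>

lemma pure_zero_left:
  assumes "y \<in> carrier S"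
  shows "pure \<zero>\<^bsub>S\<^esub> y = \<one>\<^bsub>T\<^esub>"
proof -
  interpret S: Ring.ring S by (rule ring_S)
  interpret T: comm_group T by (rule comm_group_T)
  have "pure \<zero>\<^bsub>S\<^esub> y \<otimes>\<^bsub>T\<^esub> pure \<zero>\<^bsub>S\<^esub> y = pure \<zero>\<^bsub>S\<^esub> y"
    using pure_add_left[of "\<zero>\<^bsub>S\<^esub>" "\<zero>\<^bsub>S\<^esub>" y] assms by simp
  then show ?thesis
    using assms by (simp add: pure_closed)
qed

lemma pure_zero_right:
  assumes "x \<in> carrier S"
  shows "pure x \<zero>\<^bsub>S\<^esub> = \<one>\<^bsub>T\<^esub>"
proof -
  interpret S: Ring.ring S by (rule ring_S)
  interpret T: comm_group T by (rule comm_group_T)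
  have "pure x \<zero>\<^bsub>S\<^esub> \<otimes>\<^bsub>T\<^esub> pure x \<zero>\<^bsub>S\<^esub> = pure x \<zero>\<^bsub>S\<^esub>"
    using pure_add_right[of x "\<zero>\<^bsub>S\<^esub>" "\<zero>\<^bsub>S\<^esub>"] assms by simp
  then show ?thesis
    using assms by (simp add: pure_closed)
qed

text \<open>The condition \<Delta> s = s \<Delta> is isolated for a single \<open>s\<close> and an
  arbitrary index set. Both sides are additive in \<open>s\<close>, so it can be checked on
  homogeneous elements and then summed.\<close>

definition commutes_with :: "'i set \<Rightarrow> ('i \<Rightarrow> 's) \<Rightarrow> ('i \<Rightarrow> 's) \<Rightarrow> 's \<Rightarrow> bool" where
  "commutes_with I u v s \<longleftrightarrow>
     (\<Otimes>\<^bsub>T\<^esub>i\<in>I. pure (u i) (v i \<otimes>\<^bsub>S\<^esub> s)) = (\<Otimes>\<^bsub>T\<^esub>i\<in>I. pure (s \<otimes>\<^bsub>S\<^esub> u i) (v i))"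

lemma commutes_with_zero:
  assumes "u \<in> I \<rightarrow> carrier S" "v \<in> I \<rightarrow> carrier S"
  shows "commutes_with I u v \<zero>\<^bsub>S\<^esub>"
proof -
  interpret S: Ring.ring S by (rule ring_S)
  interpret T: comm_group T by (rule comm_group_T)
  have "u i \<in> carrier S" "v i \<in> carrier S" if "i \<in> I" for i
    using assms that by auto
  then have "(\<Otimes>\<^bsub>T\<^esub>i\<in>I. pure (u i) (v i \<otimes>\<^bsub>S\<^esub> \<zero>\<^bsub>S\<^esub>)) = \<one>\<^bsub>T\<^esub>"
    "(\<Otimes>\<^bsub>T\<^esub>i\<in>I. pure (\<zero>\<^bsub>S\<^esub> \<otimes>\<^bsub>S\<^esub> u i) (v i)) = \<one>\<^bsub>T\<^esub>"
    by (auto intro!: T.finprod_one_eqI simp: pure_zero_left pure_zero_right)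
  then show ?thesis by (simp add: commutes_with_def)
qed

lemma commutes_with_add:
  assumes uv: "u \<in> I \<rightarrow> carrier S" "v \<in> I \<rightarrow> carrier S"
    and s: "s \<in> carrier S" "s' \<in> carrier S"
    and "commutes_with I u v s" "commutes_with I u v s'"
  shows "commutes_with I u v (s \<oplus>\<^bsub>S\<^esub> s')"
proof -
  interpret S: Ring.ring S by (rule ring_S)
  interpret T: comm_group T by (rule comm_group_T)
  have mem: "u i \<in> carrier S" "v i \<in> carrier S" if "i \<in> I" for i
    using uv that by auto
  have "(\<Otimes>\<^bsub>T\<^esub>i\<in>I. pure (u i) (v i \<otimes>\<^bsub>S\<^esub> (s \<oplus>\<^bsub>S\<^esub> s')))
      = (\<Otimes>\<^bsub>T\<^esub>i\<in>I. pure (u i) (v i \<otimes>\<^bsub>S\<^esub> s) \<otimes>\<^bsub>T\<^esub> pure (u i) (v i \<otimes>\<^bsub>S\<^esub> s'))"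
    using mem s by (intro T.finprod_cong') (auto simp: S.r_distr pure_add_right pure_closed)
  also have "\<dots> = (\<Otimes>\<^bsub>T\<^esub>i\<in>I. pure (u i) (v i \<otimes>\<^bsub>S\<^esub> s)) \<otimes>\<^bsub>T\<^esub> (\<Otimes>\<^bsub>T\<^esub>i\<in>I. pure (u i) (v i \<otimes>\<^bsub>S\<^esub> s'))"
    using mem s by (intro T.finprod_multf) (auto simp: pure_closed)
  also have "\<dots> = (\<Otimes>\<^bsub>T\<^esub>i\<in>I. pure (s \<otimes>\<^bsub>S\<^esub> u i) (v i)) \<otimes>\<^bsub>T\<^esub> (\<Otimes>\<^bsub>T\<^esub>i\<in>I. pure (s' \<otimes>\<^bsub>S\<^esub> u i) (v i))"
    using assms(5,6) by (simp add: commutes_with_def)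
  also have "\<dots> = (\<Otimes>\<^bsub>T\<^esub>i\<in>I. pure (s \<otimes>\<^bsub>S\<^esub> u i) (v i) \<otimes>\<^bsub>T\<^esub> pure (s' \<otimes>\<^bsub>S\<^esub> u i) (v i))"
    using mem s by (intro T.finprod_multf[symmetric]) (auto simp: pure_closed)
  also have "\<dots> = (\<Otimes>\<^bsub>T\<^esub>i\<in>I. pure ((s \<oplus>\<^bsub>S\<^esub> s') \<otimes>\<^bsub>S\<^esub> u i) (v i))"
    using mem s by (intro T.finprod_cong') (auto simp: S.l_distr pure_add_left pure_closed)
  finally show ?thesis by (simp add: commutes_with_def)
qed

text \<open>An enumeration of \<open>I\<close> transports all sums to an initial segment of the
  naturals, so \<Delta> may be indexed by the morphisms themselves.\<close>

lemma frobenius_extensionI: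
  assumes I: "finite I"
    and uv: "u \<in> I \<rightarrow> carrier S" "v \<in> I \<rightarrow> carrier S"
    and eps: "bimodule_map R S \<phi> \<epsilon>"
    and comm: "\<And>s. s \<in> carrier S \<Longrightarrow> commutes_with I u v s"
    and left: "(\<Oplus>\<^bsub>S\<^esub>i\<in>I. \<phi> (\<epsilon> (u i)) \<otimes>\<^bsub>S\<^esub> v i) = \<one>\<^bsub>S\<^esub>"
    and right: "(\<Oplus>\<^bsub>S\<^esub>i\<in>I. u i \<otimes>\<^bsub>S\<^esub> \<phi> (\<epsilon> (v i))) = \<one>\<^bsub>S\<^esub>"
  shows "frobenius_extension R S \<phi>"
proof -
  interpret S: Ring.ring S by (rule ring_S)
  interpret T: comm_group T by (rule comm_group_T)
  obtain b where "bij_betw b {..<card I} I"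
    using ex_bij_betw_nat_finite[OF I] by (auto simp: atLeast0LessThan)
  then have b: "inj_on b {..<card I}" "b ` {..<card I} = I"
    by (auto simp: bij_betw_def)
  have b_mem: "b i \<in> I" if "i < card I" for i
    using b that by auto
  have mem: "u i \<in> carrier S" "v i \<in> carrier S" if "i \<in> I" for i
    using uv that by auto
  have eps_mem: "\<phi> (\<epsilon> x) \<in> carrier S" if "x \<in> carrier S" for x
    using eps that embedding_closed by (auto simp: bimodule_map_def)
  have T_reindex: "finprod T f I = (\<Otimes>\<^bsub>T\<^esub>i\<in>{..<card I}. f (b i))" if "f \<in> I \<rightarrow> carrier T" for f
    using T.finprod_reindex[of f b "{..<card I}"] that b by simp
  have S_reindex: "finsum S f I = (\<Oplus>\<^bsub>S\<^esub>i\<in>{..<card I}. f (b i))" if "f \<in> I \<rightarrow> carrier S" for f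
    using S.finsum_reindex[of f b "{..<card I}"] that b by simp
  have 1: "(\<Otimes>\<^bsub>T\<^esub>i\<in>{..<card I}. pure (u (b i)) (v (b i) \<otimes>\<^bsub>S\<^esub> s))
      = (\<Otimes>\<^bsub>T\<^esub>i\<in>{..<card I}. pure (s \<otimes>\<^bsub>S\<^esub> u (b i)) (v (b i)))" if s: "s \<in> carrier S" for s
    using comm[OF s] T_reindex[of "\<lambda>i. pure (u i) (v i \<otimes>\<^bsub>S\<^esub> s)"]
      T_reindex[of "\<lambda>i. pure (s \<otimes>\<^bsub>S\<^esub> u i) (v i)"] mem s
    by (simp add: commutes_with_def pure_closed Pi_def)
  have 2: "(\<Oplus>\<^bsub>S\<^esub>i\<in>{..<card I}. \<phi> (\<epsilon> (u (b i))) \<otimes>\<^bsub>S\<^esub> v (b i)) = \<one>\<^bsub>S\<^esub>"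
    using left S_reindex[of "\<lambda>i. \<phi> (\<epsilon> (u i)) \<otimes>\<^bsub>S\<^esub> v i"] mem eps_mem by (simp add: Pi_def)
  have 3: "(\<Oplus>\<^bsub>S\<^esub>i\<in>{..<card I}. u (b i) \<otimes>\<^bsub>S\<^esub> \<phi> (\<epsilon> (v (b i)))) = \<one>\<^bsub>S\<^esub>"
    using right S_reindex[of "\<lambda>i. u i \<otimes>\<^bsub>S\<^esub> \<phi> (\<epsilon> (v i))"] mem eps_mem by (simp add: Pi_def)
  show ?thesis
    unfolding frobenius_extension_def
    by (rule conjI, rule extension, rule exI[of _ "card I"], rule exI[of _ "\<lambda>i. u (b i)"],
        rule exI[of _ "\<lambda>i. v (b i)"], rule exI[of _ \<epsilon>]) (use eps 1 2 3 mem b_mem in auto)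
qed

end

section \<open>The skew groupoid ring\<close>

locale finite_unital_partial_action = unital_partial_action +
  assumes finite_mor: "finite (mor G)"
begin

abbreviation "S \<equiv> skew_groupoid_ring G D \<alpha>"
abbreviation "delta \<equiv> Poly_Mapping.single"
abbreviation "coeff \<equiv> Poly_Mapping.lookup"

lemma finite_objects: "finite (objects G)"
  using finite_mor objects_subset_mor by (rule rev_finite_subset)

text \<open>The sums run over all morphisms instead of the supports, so the index sets do not depend
  on the arguments and biadditivity can be checked term by term.\<close>

definition convolve where
  "convolve p q = (\<Sum>g\<in>mor G. \<Sum>h\<in>mor G. if src G g = tgt G h
     then delta (cmp G g h) (coeff p g * act g (coeff q h)) else 0)"

text \<open>The added terms carry a zero coefficient: on the left directly, on the right through
  \<open>act_zero\<close>.\<close>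

lemma skew_mult_eq_convolve:
  assumes p: "Poly_Mapping.keys p \<subseteq> mor G" and q: "Poly_Mapping.keys q \<subseteq> mor G"
  shows "skew_mult G D \<alpha> p q = convolve p q"
proof -
  let ?X = "\<lambda>g h. if src G g = tgt G h
     then delta (cmp G g h) (coeff p g * act g (coeff q h)) else 0"
  have "skew_mult G D \<alpha> p q = (\<Sum>g\<in>Poly_Mapping.keys p. \<Sum>h\<in>Poly_Mapping.keys q. ?X g h)"
    by (simp add: skew_mult_def act_def cong: if_cong)
  also have "\<dots> = (\<Sum>g\<in>Poly_Mapping.keys p. \<Sum>h\<in>mor G. ?X g h)"
    using p q finite_mor
    by (intro sum.cong refl sum.mono_neutral_left) (auto simp: in_keys_iff act_zero)
  also have "\<dots> = (\<Sum>g\<in>mor G. \<Sum>h\<in>mor G. ?X g h)"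
    using p finite_mor
    by (intro sum.mono_neutral_left ballI sum.neutral) (auto simp: in_keys_iff)
  finally show ?thesis by (simp add: convolve_def)
qed

lemma convolve_add_left: "convolve (p + p') q = convolve p q + convolve p' q"
  unfolding convolve_def sum.distrib[symmetric]
  by (intro sum.cong refl) (auto simp: lookup_add distrib_right single_add)

lemma convolve_add_right: "convolve p (q + q') = convolve p q + convolve p q'"
  unfolding convolve_def sum.distrib[symmetric]
  by (intro sum.cong refl) (auto simp: lookup_add distrib_left single_add act_add)

lemma convolve_zero_left: "convolve 0 q = 0"
  by (simp add: convolve_def cong: if_cong)

lemma convolve_zero_right: "convolve p 0 = 0"
  by (simp add: convolve_def act_zero cong: if_cong)

lemma convolve_sum_left: "convolve (\<Sum>i\<in>I. f i) q = (\<Sum>i\<in>I. convolve (f i) q)"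
  by (induction I rule: infinite_finite_induct) (simp_all add: convolve_add_left convolve_zero_left)

lemma convolve_sum_right: "convolve p (\<Sum>i\<in>I. f i) = (\<Sum>i\<in>I. convolve p (f i))"
  by (induction I rule: infinite_finite_induct) (simp_all add: convolve_add_right convolve_zero_right)

lemma convolve_delta:
  assumes "g \<in> mor G" "h \<in> mor G"
  shows "convolve (delta g a) (delta h b) =
    (if src G g = tgt G h then delta (cmp G g h) (a * act g b) else 0)" (is "_ = ?rhs")
proof -
  \<comment> \<open>Every term is written as an indicator of the pair \<open>(g, h)\<close> so that
    the double sum collapses.\<close>
  have "convolve (delta g a) (delta h b)
      = (\<Sum>g'\<in>mor G. if g' = g then (\<Sum>h'\<in>mor G. if h' = h then ?rhs else 0) else 0)"
    unfolding convolve_def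
  proof (intro sum.cong refl)
    fix g' assume "g' \<in> mor G"
    show "(\<Sum>h'\<in>mor G. if src G g' = tgt G h' then delta (cmp G g' h')
        (coeff (delta g a) g' * act g' (coeff (delta h b) h')) else 0)
      = (if g' = g then \<Sum>h'\<in>mor G. if h' = h then ?rhs else 0 else 0)"
    proof (cases "g' = g")
      case True
      show ?thesis
        unfolding True simp_thms if_True
        using assms(1) by (intro sum.cong refl) (auto simp: lookup_single when_def act_zero)
    next
      case False
      then show ?thesis by (simp add: lookup_single when_def sum.neutral)
    qed
  qed
  also have "\<dots> = ?rhs"
    using assms finite_mor by simp
  finally show ?thesis .
qed

section \<open>Carrier and associativity of the skew groupoid ring\<close>

lemma skew_carrier_iff:
  "p \<in> carrier S \<longleftrightarrow> Poly_Mapping.keys p \<subseteq> mor G \<and> (\<forall>g\<in>mor G. coeff p g \<in> D g)"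
  by (simp add: skew_groupoid_ring_def)

lemma skew_add: "p \<oplus>\<^bsub>S\<^esub> q = p + q"
  by (simp add: skew_groupoid_ring_def)

lemma skew_zero: "\<zero>\<^bsub>S\<^esub> = 0"
  by (simp add: skew_groupoid_ring_def)

lemma skew_one: "\<one>\<^bsub>S\<^esub> = (\<Sum>y\<in>objects G. delta y (idem y))"
  by (simp add: skew_groupoid_ring_def)

lemma skew_times: "p \<in> carrier S \<Longrightarrow> q \<in> carrier S \<Longrightarrow> p \<otimes>\<^bsub>S\<^esub> q = convolve p q"
  by (simp add: skew_groupoid_ring_def skew_mult_eq_convolve)

lemma coeff_mem: "p \<in> carrier S \<Longrightarrow> g \<in> mor G \<Longrightarrow> coeff p g \<in> D g"
  by (simp add: skew_carrier_iff)

lemma delta_mem: "g \<in> mor G \<Longrightarrow> a \<in> D g \<Longrightarrow> delta g a \<in> carrier S"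
  by (auto simp: skew_carrier_iff lookup_single when_def D_zero)

lemma zero_mem: "0 \<in> carrier S"
  by (simp add: skew_carrier_iff D_zero)

lemma add_mem: "p \<in> carrier S \<Longrightarrow> q \<in> carrier S \<Longrightarrow> p + q \<in> carrier S"
  using keys_add[of p q] by (auto simp: skew_carrier_iff lookup_add D_add)

lemma uminus_mem: "p \<in> carrier S \<Longrightarrow> - p \<in> carrier S"
  by (auto simp: skew_carrier_iff D_uminus)

lemma sum_mem: "(\<And>i. i \<in> I \<Longrightarrow> f i \<in> carrier S) \<Longrightarrow> (\<Sum>i\<in>I. f i) \<in> carrier S"
  by (induction I rule: infinite_finite_induct) (auto simp: add_mem zero_mem)

text \<open>Reduces additive identities in the ring to homogeneous elements.\<close>

lemma delta_expansion:
  assumes "p \<in> carrier S"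
  shows "(\<Sum>g\<in>mor G. delta g (coeff p g)) = p"
proof (rule poly_mapping_eqI)
  fix k
  have "coeff p k = 0" if "k \<notin> mor G"
    using assms that by (auto simp: skew_carrier_iff in_keys_iff)
  then show "coeff (\<Sum>g\<in>mor G. delta g (coeff p g)) k = coeff p k"
    using finite_mor by (simp add: lookup_sum lookup_single when_def)
qed

lemma convolve_mem:
  assumes "p \<in> carrier S" "q \<in> carrier S"
  shows "convolve p q \<in> carrier S"
  unfolding convolve_def
  using assms
  by (intro sum_mem) (simp add: zero_mem delta_mem cmp_closed D_mult_left act_mem_cmp coeff_mem)

text \<open>For composable morphisms the right-hand coefficient has the extra factor
  \<open>idem g\<close> from \<open>act_act\<close>. It is central and is absorbed by
  \<open>a\<close>, which lies in \<open>D g\<close>.\<close>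

lemma convolve_delta_assoc:
  assumes g: "g \<in> mor G" "a \<in> D g" and h: "h \<in> mor G" and k: "k \<in> mor G"
  shows "convolve (convolve (delta g a) (delta h b)) (delta k c)
    = convolve (delta g a) (convolve (delta h b) (delta k c))"
proof (cases "src G g = tgt G h \<and> src G h = tgt G k")
  case True
  let ?x = "act g b" and ?y = "act (cmp G g h) c"
  have "a * act g (b * act h c) = a * (?x * ?y * idem g)"
    using g h True by (simp add: act_mult act_act mult.assoc)
  also have "?x * ?y * idem g = idem g * (?x * ?y)"
    using g(1) by (rule idem_central)
  also have "a * \<dots> = a * ?x * ?y"
    using mult_idem[OF g] by (simp add: mult.assoc[symmetric])
  finally show ?thesis
    using True g h k by (simp add: convolve_delta cmp_closed src_cmp tgt_cmp cmp_assoc)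
next
  \<comment> \<open>If either adjacent pair fails to compose, both bracketings are zero, since
    composition preserves the outer source and target.\<close>
  case False
  then show ?thesis
    using g h k
    by (auto simp: convolve_delta convolve_zero_left convolve_zero_right cmp_closed src_cmp tgt_cmp)
qed

lemma convolve_assoc:
  assumes "p \<in> carrier S" "q \<in> carrier S" "r \<in> carrier S"
  shows "convolve (convolve p q) r = convolve p (convolve q r)"
proof -
  have "convolve (convolve (\<Sum>g\<in>mor G. delta g (coeff p g)) (\<Sum>h\<in>mor G. delta h (coeff q h)))
        (\<Sum>k\<in>mor G. delta k (coeff r k))
      = convolve (\<Sum>g\<in>mor G. delta g (coeff p g))
          (convolve (\<Sum>h\<in>mor G. delta h (coeff q h)) (\<Sum>k\<in>mor G. delta k (coeff r k)))"
    unfolding convolve_sum_left convolve_sum_right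
    by (intro sum.cong refl) (simp add: convolve_delta_assoc coeff_mem assms)
  then show ?thesis by (simp only: delta_expansion assms)
qed

text \<open>The common shape of the identity and of the embedded scalars, so that multiplication by
  either is computed once.\<close>

definition diagonal where "diagonal c = (\<Sum>y\<in>objects G. delta y (c y))"

lemma one_eq_diagonal: "\<one>\<^bsub>S\<^esub> = diagonal idem"
  by (simp add: skew_one diagonal_def)

lemma embedding_eq_diagonal: "skew_embedding G D a = diagonal (\<lambda>y. a * idem y)"
  by (simp add: skew_embedding_def diagonal_def)

lemma diagonal_mem: "(\<And>y. y \<in> objects G \<Longrightarrow> c y \<in> D y) \<Longrightarrow> diagonal c \<in> carrier S"
  unfolding diagonal_def using objectD by (intro sum_mem delta_mem) auto

text \<open>Only the object \<open>tgt G g\<close> composes with \<open>g\<close> on this side, and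
  its map fixes \<open>a\<close> because \<open>D g\<close> is contained in
  \<open>D (tgt G g)\<close>.\<close>

lemma convolve_diagonal_left:
  assumes g: "g \<in> mor G" and a: "a \<in> D g"
  shows "convolve (diagonal c) (delta g a) = delta g (c (tgt G g) * a)"
proof -
  have "convolve (diagonal c) (delta g a)
      = (\<Sum>y\<in>objects G. if y = tgt G g then delta g (c y * act y a) else 0)"
    unfolding diagonal_def convolve_sum_left
    using g objectD by (intro sum.cong refl) (auto simp: convolve_delta cmp_tgt)
  also have "\<dots> = delta g (c (tgt G g) * a)"
    using g tgt_object[OF g] objectD[OF tgt_object[OF g]] mult_idem[OF _ D_subset_tgt[OF g a]]
    by (simp add: finite_objects act_object)
  finally show ?thesis .
qed

lemma convolve_diagonal_right:
  assumes g: "g \<in> mor G"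
  shows "convolve (delta g a) (diagonal c) = delta g (a * act g (c (src G g)))"
proof -
  have "convolve (delta g a) (diagonal c)
      = (\<Sum>y\<in>objects G. if y = src G g then delta g (a * act g (c y)) else 0)"
    unfolding diagonal_def convolve_sum_right
    using g objectD by (intro sum.cong refl) (auto simp: convolve_delta cmp_src)
  also have "\<dots> = delta g (a * act g (c (src G g)))"
    using src_object[OF g] by (simp add: finite_objects)
  finally show ?thesis .
qed

text \<open>The domain \<open>D (ginv G g)\<close> lies inside \<open>D (src G g)\<close>, so the
  larger unit is absorbed by the one already built into \<open>act\<close>.\<close>

lemma act_mult_idem_src:
  assumes g: "g \<in> mor G"
  shows "act g (r * idem (src G g)) = act g r"
proof -
  have "idem (src G g) * idem (ginv G g) = idem (ginv G g)"
    using g src_object[OF g] objectD idem_mem[of "ginv G g"] D_subset_tgt[of "ginv G g"]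
    by (intro idem_mult) auto
  then show ?thesis by (simp add: act_def mult.assoc)
qed

lemma act_idem_src: "g \<in> mor G \<Longrightarrow> act g (idem (src G g)) = idem g"
  using act_idem[of g "src G g"] src_object[of g] objectD by (simp add: cmp_src idem_idem)

lemma convolve_embedding_left:
  assumes "g \<in> mor G" "a \<in> D g"
  shows "convolve (skew_embedding G D r) (delta g a) = delta g (r * a)"
  using assms objectD[OF tgt_object, of g] idem_mult[OF _ D_subset_tgt, of g a]
  by (simp add: embedding_eq_diagonal convolve_diagonal_left mult.assoc)

lemma convolve_embedding_right:
  assumes "g \<in> mor G"
  shows "convolve (delta g a) (skew_embedding G D r) = delta g (a * act g r)"
  using assms by (simp add: embedding_eq_diagonal convolve_diagonal_right act_mult_idem_src)

lemma embedding_mem: "skew_embedding G D r \<in> carrier S"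
  unfolding embedding_eq_diagonal using objectD by (auto intro!: diagonal_mem simp: D_mult_left idem_mem)

lemma one_mem: "\<one>\<^bsub>S\<^esub> \<in> carrier S"
  unfolding one_eq_diagonal using objectD by (auto intro!: diagonal_mem simp: idem_mem)

lemma convolve_one_left:
  assumes "p \<in> carrier S"
  shows "convolve \<one>\<^bsub>S\<^esub> p = p"
proof -
  have "convolve (diagonal idem) (\<Sum>g\<in>mor G. delta g (coeff p g)) = (\<Sum>g\<in>mor G. delta g (coeff p g))"
    unfolding convolve_sum_right using assms objectD[OF tgt_object]
    by (intro sum.cong refl) (simp add: convolve_diagonal_left coeff_mem idem_mult D_subset_tgt)
  then show ?thesis by (simp only: one_eq_diagonal delta_expansion assms)
qed

lemma convolve_one_right:
  assumes "p \<in> carrier S"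
  shows "convolve p \<one>\<^bsub>S\<^esub> = p"
proof -
  have "convolve (\<Sum>g\<in>mor G. delta g (coeff p g)) (diagonal idem) = (\<Sum>g\<in>mor G. delta g (coeff p g))"
    unfolding convolve_sum_left using assms
    by (intro sum.cong refl) (simp add: convolve_diagonal_right coeff_mem mult_idem act_idem_src)
  then show ?thesis by (simp only: one_eq_diagonal delta_expansion assms)
qed

lemma skew_ring: "Ring.ring S"
proof (rule ringI)
  show "abelian_group S"
  proof (rule abelian_groupI)
    show "\<exists>y\<in>carrier S. y \<oplus>\<^bsub>S\<^esub> x = \<zero>\<^bsub>S\<^esub>" if "x \<in> carrier S" for x
      using that by (auto intro!: bexI[of _ "- x"] simp: skew_add skew_zero uminus_mem)
  qed (auto simp: skew_add skew_zero add_mem zero_mem add.assoc add.commute)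
  show "monoid S"
    by (rule monoidI)
       (auto simp: skew_times convolve_mem one_mem convolve_assoc convolve_one_left convolve_one_right)
qed (auto simp: skew_add skew_times add_mem convolve_add_left convolve_add_right)

lemma skew_finsum:
  assumes "finite I" "\<And>i. i \<in> I \<Longrightarrow> f i \<in> carrier S"
  shows "(\<Oplus>\<^bsub>S\<^esub>i\<in>I. f i) = (\<Sum>i\<in>I. f i)"
proof -
  interpret S: Ring.ring S by (rule skew_ring)
  show ?thesis
    using assms by (induction I) (simp_all add: skew_zero skew_add S.finsum_insert Pi_def)
qed

section \<open>Scalar multiplication on coefficients and the Frobenius form\<close>

lemma coeff_convolve_embedding_left:
  assumes p: "p \<in> carrier S" and k: "k \<in> mor G"
  shows "coeff (convolve (skew_embedding G D r) p) k = r * coeff p k"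
proof -
  have "convolve (skew_embedding G D r) (\<Sum>g\<in>mor G. delta g (coeff p g))
      = (\<Sum>g\<in>mor G. delta g (r * coeff p g))"
    unfolding convolve_sum_right using p
    by (intro sum.cong refl) (simp add: convolve_embedding_left coeff_mem)
  then show ?thesis
    using k finite_mor by (simp add: delta_expansion p lookup_sum lookup_single when_def)
qed

lemma coeff_convolve_embedding_right:
  assumes p: "p \<in> carrier S" and k: "k \<in> mor G"
  shows "coeff (convolve p (skew_embedding G D r)) k = coeff p k * act k r"
proof -
  have "convolve (\<Sum>g\<in>mor G. delta g (coeff p g)) (skew_embedding G D r)
      = (\<Sum>g\<in>mor G. delta g (coeff p g * act g r))"
    unfolding convolve_sum_left by (intro sum.cong refl) (simp add: convolve_embedding_right)
  then show ?thesis
    using k finite_mor by (simp add: delta_expansion p lookup_sum lookup_single when_def)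
qed

definition trace where "trace p = (\<Sum>y\<in>objects G. coeff p y)"

lemma trace_add: "trace (p + q) = trace p + trace q"
  by (simp add: trace_def lookup_add sum.distrib)

lemma trace_delta: "trace (delta g a) = (if g \<in> objects G then a else 0)"
  using finite_objects by (simp add: trace_def lookup_single when_def)

lemma trace_embedding_left:
  assumes "p \<in> carrier S"
  shows "trace (convolve (skew_embedding G D r) p) = r * trace p"
  unfolding trace_def sum_distrib_left
  using assms objectD by (intro sum.cong refl) (simp add: coeff_convolve_embedding_left)

text \<open>Right scalars are twisted by \<open>act\<close>, but at an object \<open>y\<close> the
  twist is only multiplication by \<open>idem y\<close>, which the coefficient at \<open>y\<close>
  absorbs.\<close>

lemma trace_embedding_right:
  assumes "p \<in> carrier S"
  shows "trace (convolve p (skew_embedding G D r)) = trace p * r"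
  unfolding trace_def sum_distrib_right
proof (intro sum.cong refl)
  fix y assume y: "y \<in> objects G"
  then have "coeff p y * (r * idem y) = coeff p y * r"
    using idem_central[of y r] mult_idem[of y "coeff p y"] assms objectD[of y]
    by (simp add: coeff_mem mult.assoc[symmetric])
  then show "coeff (convolve p (skew_embedding G D r)) y = coeff p y * r"
    using y assms objectD[of y] by (simp add: coeff_convolve_embedding_right act_object)
qed

end

section \<open>The Frobenius structure\<close>

locale unital_partial_action_direct_sum = finite_unital_partial_action +
  assumes direct_sum: "is_direct_sum (objects G) D"
begin

section \<open>The direct sum decomposition of the base ring\<close>

abbreviation "R \<equiv> base_ring G D"

lemma D_disjoint:
  assumes y: "y \<in> objects G" "a \<in> D y" and z: "z \<in> objects G" "a \<in> D z" and "y \<noteq> z"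
  shows "a = 0"
proof -
  \<comment> \<open>The families with \<open>a\<close> placed in slot \<open>y\<close> and in slot
    \<open>z\<close> have the same sum, so uniqueness of the decomposition makes them equal.\<close>
  let ?f = "\<lambda>w. \<lambda>i\<in>objects G. if i = w then a else 0"
  have "(\<Sum>i\<in>objects G. ?f w i) = (\<Sum>i\<in>objects G. if i = w then a else 0)" for w
    by (rule sum.cong) simp_all
  then have "(\<Sum>i\<in>objects G. ?f y i) = (\<Sum>i\<in>objects G. ?f z i)"
    using y z finite_objects by simp
  moreover have "?f y \<in> (\<Pi>\<^sub>E i\<in>objects G. D i)" "?f z \<in> (\<Pi>\<^sub>E i\<in>objects G. D i)"
    using y z objectD D_zero by auto
  ultimately have "?f y = ?f z"
    using direct_sum unfolding is_direct_sum_def bij_betw_def inj_on_def by blast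
  then have "?f y y = ?f z y" by simp
  then show ?thesis using y \<open>y \<noteq> z\<close> by simp
qed

text \<open>The product lies in both ideals, which meet only in zero.\<close>

lemma D_mult_eq_0:
  assumes "y \<in> objects G" "z \<in> objects G" "y \<noteq> z" "a \<in> D y" "b \<in> D z"
  shows "a * b = 0"
  using assms D_disjoint[of y "a * b" z] objectD by (simp add: D_mult_left D_mult_right)

lemma sum_decomposition:
  obtains f where "\<And>y. y \<in> objects G \<Longrightarrow> f y \<in> D y" "a = (\<Sum>y\<in>objects G. f y)"
proof -
  have "a \<in> (\<lambda>f. \<Sum>i\<in>objects G. f i) ` (\<Pi>\<^sub>E i\<in>objects G. D i)"
    using direct_sum by (simp add: is_direct_sum_def bij_betw_def)
  then show ?thesis using that by (auto simp: PiE_iff)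
qed

lemma mult_idem_sum:
  assumes z: "z \<in> objects G" and f: "\<And>y. y \<in> objects G \<Longrightarrow> f y \<in> D y"
  shows "(\<Sum>y\<in>objects G. f y) * idem z = f z"
proof -
  have "(\<Sum>y\<in>objects G. f y) * idem z = (\<Sum>y\<in>objects G. if y = z then f y else 0)"
    unfolding sum_distrib_right
    using z f objectD by (intro sum.cong refl) (auto simp: D_mult_eq_0 idem_mem mult_idem)
  then show ?thesis using z finite_objects by simp
qed

text \<open>Multiplication by \<open>idem y\<close> is the projection to the summand
  \<open>D y\<close>. Hence the sum of these units is an identity of the base ring.\<close>

lemma sum_mult_idem: "(\<Sum>y\<in>objects G. a * idem y) = a"
proof -
  obtain f where f: "\<And>y. y \<in> objects G \<Longrightarrow> f y \<in> D y" "a = (\<Sum>y\<in>objects G. f y)"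
    using sum_decomposition[of a] by blast
  have "(\<Sum>y\<in>objects G. a * idem y) = (\<Sum>y\<in>objects G. f y)"
    by (intro sum.cong refl) (simp add: f(2) mult_idem_sum f(1))
  then show ?thesis by (simp add: f(2))
qed

section \<open>The unital ring extension\<close>

lemma base_ring: "Ring.ring R"
proof (rule ringI)
  show "abelian_group R"
  proof (rule abelian_groupI)
    show "\<exists>y\<in>carrier R. y \<oplus>\<^bsub>R\<^esub> x = \<zero>\<^bsub>R\<^esub>" for x
      by (auto intro!: exI[of _ "- x"] simp: base_ring_def)
  qed (auto simp: base_ring_def add.assoc add.commute)
  have "(\<Sum>y\<in>objects G. idem y) * a = a" for a
  proof -
    have "(\<Sum>y\<in>objects G. idem y) * a = (\<Sum>y\<in>objects G. a * idem y)"
      unfolding sum_distrib_right using objectD by (intro sum.cong refl) (simp add: idem_central)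
    then show ?thesis by (simp add: sum_mult_idem)
  qed
  moreover have "a * (\<Sum>y\<in>objects G. idem y) = a" for a
    by (simp add: sum_distrib_left sum_mult_idem)
  ultimately show "monoid R"
    by (intro monoidI) (auto simp: base_ring_def mult.assoc)
qed (auto simp: base_ring_def distrib_left distrib_right)

lemma embedding_add:
  "skew_embedding G D (a + b) = skew_embedding G D a + skew_embedding G D b"
  by (simp add: skew_embedding_def distrib_right single_add sum.distrib)

lemma embedding_mult:
  "skew_embedding G D (a * b) = convolve (skew_embedding G D a) (skew_embedding G D b)"
  \<comment> \<open>Only the right factor is expanded, so that
    \<open>convolve_embedding_left\<close> applies to each term.\<close>
  unfolding skew_embedding_def[of G D b] convolve_sum_right
  unfolding skew_embedding_def[of G D "a * b"]
  using objectD
  by (intro sum.cong refl) (simp add: convolve_embedding_left D_mult_left idem_mem mult.assoc)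

lemma embedding_one: "skew_embedding G D (\<Sum>y\<in>objects G. idem y) = \<one>\<^bsub>S\<^esub>"
  unfolding skew_embedding_def skew_one
  using objectD by (intro sum.cong refl) (simp add: mult_idem_sum idem_mem)

text \<open>The form \<open>trace\<close> is a left inverse of the embedding.\<close>

lemma embedding_inj: "inj (skew_embedding G D)"
proof (rule injI)
  fix a b assume eq: "skew_embedding G D a = skew_embedding G D b"
  have "trace (skew_embedding G D c) = c" for c
  proof -
    have "trace (skew_embedding G D c) = (\<Sum>y\<in>objects G. c * idem y)"
      unfolding trace_def using finite_objects
      by (intro sum.cong refl) (simp add: skew_embedding_def lookup_sum lookup_single when_def)
    then show ?thesis by (simp add: sum_mult_idem)
  qed
  then show "a = b" by (metis eq)
qed

lemma skew_ring_extension: "ring_extension R S (skew_embedding G D)"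
  unfolding ring_extension_def
proof (intro conjI)
  show "skew_embedding G D \<in> ring_hom R S"
    unfolding ring_hom_def
    using embedding_mem
    by (auto simp: base_ring_def skew_times skew_add embedding_add embedding_mult embedding_one)
  show "inj_on (skew_embedding G D) (carrier R)"
    using embedding_inj by (rule inj_on_subset) simp
qed (rule base_ring skew_ring)+

sublocale extension_tensor R S "skew_embedding G D"
  by unfold_locales (rule skew_ring_extension)

lemma trace_bimodule_map: "bimodule_map R S (skew_embedding G D) trace"
  unfolding bimodule_map_def
  by (auto simp: base_ring_def skew_add skew_times embedding_mem trace_add
      trace_embedding_left trace_embedding_right)

section \<open>The two legs of \<Delta> and its commutation with the ring\<close>

definition dual_left where "dual_left g = delta g (idem g)"
definition dual_right where "dual_right g = delta (ginv G g) (idem (ginv G g))"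

lemma dual_left_mem: "g \<in> mor G \<Longrightarrow> dual_left g \<in> carrier S"
  by (simp add: dual_left_def delta_mem idem_mem)

lemma dual_right_mem: "g \<in> mor G \<Longrightarrow> dual_right g \<in> carrier S"
  by (simp add: dual_right_def delta_mem idem_mem)

lemma pure_dual_shift:
  assumes h: "h \<in> mor G" "a \<in> D h" and k: "k \<in> mor G" "tgt G k = src G h"
  shows "pure (dual_left (cmp G h k)) (dual_right (cmp G h k) \<otimes>\<^bsub>S\<^esub> delta h a)
    = pure (delta h a \<otimes>\<^bsub>S\<^esub> dual_left k) (dual_right k)"
proof -
  let ?g = "cmp G h k"
  \<comment> \<open>The two tensors differ by moving the scalar \<open>?r\<close> across the tensor sign.\<close>
  let ?r = "act (ginv G ?g) a"
  have g: "?g \<in> mor G" "src G ?g = src G k" "tgt G ?g = tgt G h"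
    using h k by (simp_all add: cmp_closed src_cmp tgt_cmp)
  have gh: "cmp G (ginv G ?g) h = ginv G k"
    using h k cmp_assoc[of "ginv G k" "ginv G h" h] cmp_src[of "ginv G k"] by (simp add: ginv_cmp)
  have r: "?r \<in> D (ginv G k)"
    using act_mem_cmp[of "ginv G ?g" h a] h g gh by simp
  have "dual_right ?g \<otimes>\<^bsub>S\<^esub> delta h a = delta (ginv G k) (idem (ginv G ?g) * ?r)"
    using g h gh by (simp add: skew_times dual_right_mem delta_mem)
                    (simp add: dual_right_def convolve_delta)
  \<comment> \<open>The scalar lies in both ideals, so one unit can be exchanged for the
    other.\<close>
  also have "idem (ginv G ?g) * ?r = ?r * idem (ginv G k)"
    using g k r by (simp add: idem_mult act_mem mult_idem)
  also have "delta (ginv G k) \<dots> = skew_embedding G D ?r \<otimes>\<^bsub>S\<^esub> dual_right k"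
    using k by (simp add: skew_times dual_right_mem embedding_mem)
               (simp add: dual_right_def convolve_embedding_left idem_mem)
  finally have right: "dual_right ?g \<otimes>\<^bsub>S\<^esub> delta h a = skew_embedding G D ?r \<otimes>\<^bsub>S\<^esub> dual_right k" .
  have "delta h a \<otimes>\<^bsub>S\<^esub> dual_left k = delta ?g (a * (idem h * idem ?g))"
    using h k by (simp add: skew_times dual_left_mem delta_mem)
                 (simp add: dual_left_def convolve_delta act_idem)
  also have "a * (idem h * idem ?g) = a * idem ?g"
    using h by (simp add: mult.assoc[symmetric] mult_idem)
  \<comment> \<open>Applying \<open>act ?g\<close> to \<open>?r\<close> composes \<open>?g\<close>
    with its inverse. By \<open>act_act\<close> this gives the map at the object
    \<open>tgt G h\<close>, which fixes \<open>a\<close>, followed by the factor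
    \<open>idem ?g\<close>.\<close>
  also have "\<dots> = idem ?g * act ?g ?r"
  proof -
    have "act ?g ?r = a * idem (tgt G h) * idem ?g"
      using act_act[of ?g "ginv G ?g" a] g h act_object[OF tgt_object] by simp
    also have "\<dots> = a * idem ?g"
      using h objectD[OF tgt_object[OF h(1)]] by (simp add: mult_idem D_subset_tgt)
    finally have "act ?g ?r = a * idem ?g" .
    then show ?thesis using idem_mult[OF g(1) act_mem[OF g(1), of ?r]] by simp
  qed
  also have "delta ?g \<dots> = dual_left ?g \<otimes>\<^bsub>S\<^esub> skew_embedding G D ?r"
    using g by (simp add: skew_times dual_left_mem embedding_mem)
               (simp add: dual_left_def convolve_embedding_right)
  finally have left: "delta h a \<otimes>\<^bsub>S\<^esub> dual_left k = dual_left ?g \<otimes>\<^bsub>S\<^esub> skew_embedding G D ?r" .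
  show ?thesis
    unfolding left right
    using g k by (intro pure_balanced[symmetric]) (simp_all add: dual_left_mem dual_right_mem base_ring_def)
qed

text \<open>The left product can be nontrivial only at morphisms with target \<open>tgt G h\<close>,
  the right one only at those with target \<open>src G h\<close>. Translation by \<open>h\<close>
  identifies these index sets, and \<open>pure_dual_shift\<close> matches the terms.\<close>

lemma dual_commutes_with_delta:
  assumes h: "h \<in> mor G" "a \<in> D h"
  shows "commutes_with (mor G) dual_left dual_right (delta h a)"
proof -
  interpret S: Ring.ring S by (rule skew_ring)
  interpret T: comm_group T by (rule comm_group_T)
  let ?d = "delta h a"
  let ?A = "{g \<in> mor G. tgt G g = tgt G h}" and ?B = "{g \<in> mor G. tgt G g = src G h}"
  have d: "?d \<in> carrier S" using h by (rule delta_mem)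
  have image: "cmp G h ` ?B = ?A" "inj_on (cmp G h) ?B"
    using bij_betw_cmp_left[OF h(1)] by (auto simp: bij_betw_def)
  have "dual_right g \<otimes>\<^bsub>S\<^esub> ?d = \<zero>\<^bsub>S\<^esub>" if "g \<in> mor G" "tgt G g \<noteq> tgt G h" for g
    using that h d by (simp add: skew_times dual_right_mem skew_zero)
                      (simp add: dual_right_def convolve_delta)
  then have "(\<Otimes>\<^bsub>T\<^esub>g\<in>mor G. pure (dual_left g) (dual_right g \<otimes>\<^bsub>S\<^esub> ?d))
      = (\<Otimes>\<^bsub>T\<^esub>g\<in>?A. pure (dual_left g) (dual_right g \<otimes>\<^bsub>S\<^esub> ?d))"
    using d finite_mor
    by (intro T.finprod_mono_neutral_cong_right)
       (auto simp: dual_left_mem dual_right_mem pure_zero_right pure_closed)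
  also have "\<dots> = (\<Otimes>\<^bsub>T\<^esub>k\<in>?B. pure (dual_left (cmp G h k)) (dual_right (cmp G h k) \<otimes>\<^bsub>S\<^esub> ?d))"
    unfolding image(1)[symmetric] using image d
    by (intro T.finprod_reindex) (auto simp: dual_left_mem dual_right_mem pure_closed)
  also have "\<dots> = (\<Otimes>\<^bsub>T\<^esub>k\<in>?B. pure (?d \<otimes>\<^bsub>S\<^esub> dual_left k) (dual_right k))"
    using h d by (intro T.finprod_cong')
      (auto simp: pure_dual_shift dual_left_mem dual_right_mem pure_closed)
  also have "\<dots> = (\<Otimes>\<^bsub>T\<^esub>k\<in>mor G. pure (?d \<otimes>\<^bsub>S\<^esub> dual_left k) (dual_right k))"
  proof (rule T.finprod_mono_neutral_cong_left)
    have "?d \<otimes>\<^bsub>S\<^esub> dual_left g = \<zero>\<^bsub>S\<^esub>" if "g \<in> mor G" "tgt G g \<noteq> src G h" for g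
      using that h d by (simp add: skew_times dual_left_mem skew_zero)
                        (simp add: dual_left_def convolve_delta)
    then show "pure (?d \<otimes>\<^bsub>S\<^esub> dual_left g) (dual_right g) = \<one>\<^bsub>T\<^esub>" if "g \<in> mor G - ?B" for g
      using that by (simp add: dual_right_mem pure_zero_left)
  qed (use finite_mor d in \<open>auto simp: dual_left_mem dual_right_mem pure_closed\<close>)
  finally show ?thesis by (simp add: commutes_with_def)
qed

lemma dual_commutes_with:
  assumes s: "s \<in> carrier S"
  shows "commutes_with (mor G) dual_left dual_right s"
proof -
  \<comment> \<open>The claim is generalised to partial sums of the homogeneous expansion to allow
    induction.\<close>
  have "commutes_with (mor G) dual_left dual_right (\<Sum>h\<in>H. delta h (coeff s h))"
    if "finite H" "H \<subseteq> mor G" for H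
    using that
  proof (induction H)
    case empty
    then show ?case
      using commutes_with_zero[of dual_left "mor G" dual_right]
      by (simp add: skew_zero dual_left_mem dual_right_mem)
  next
    case (insert h H)
    then have "(\<Sum>h\<in>H. delta h (coeff s h)) \<in> carrier S"
      by (intro sum_mem) (auto simp: delta_mem coeff_mem s)
    then show ?case
      using insert commutes_with_add[of dual_left "mor G" dual_right "delta h (coeff s h)"
          "\<Sum>h\<in>H. delta h (coeff s h)"]
      by (simp add: skew_add dual_left_mem dual_right_mem dual_commutes_with_delta delta_mem coeff_mem s)
  qed
  from this[OF finite_mor subset_refl] show ?thesis by (simp only: delta_expansion s)
qed

lemma frobenius: "frobenius_extension R S (skew_embedding G D)"
proof (rule frobenius_extensionI[OF finite_mor _ _ trace_bimodule_map dual_commutes_with])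
  interpret S: Ring.ring S by (rule skew_ring)
  show "dual_left \<in> mor G \<rightarrow> carrier S" "dual_right \<in> mor G \<rightarrow> carrier S"
    by (simp_all add: dual_left_mem dual_right_mem)
  \<comment> \<open>The form vanishes on a term supported off the objects, and inversion preserves
    being an object. Both sums therefore reduce to the terms \<open>delta y (idem y)\<close> at
    objects, which add up to the identity.\<close>
  have object_iff: "ginv G g \<in> objects G \<longleftrightarrow> g \<in> objects G" if "g \<in> mor G" for g
    using ginv_object ginv_ginv[OF that] by metis
  have left: "skew_embedding G D (trace (dual_left g)) \<otimes>\<^bsub>S\<^esub> dual_right g
      = (if g \<in> objects G then delta g (idem g) else 0)" if "g \<in> mor G" for g
    using that by (simp add: skew_times embedding_mem dual_right_mem)
      (simp add: dual_left_def dual_right_def convolve_embedding_left idem_mem trace_delta idem_idem)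
  have right: "dual_left g \<otimes>\<^bsub>S\<^esub> skew_embedding G D (trace (dual_right g))
      = (if g \<in> objects G then delta g (idem g) else 0)" if "g \<in> mor G" for g
    using that by (simp add: skew_times embedding_mem dual_left_mem)
      (simp add: dual_left_def dual_right_def convolve_embedding_right trace_delta object_iff
        act_zero act_object idem_idem)
  have one: "(\<Sum>g\<in>mor G. if g \<in> objects G then delta g (idem g) else 0) = \<one>\<^bsub>S\<^esub>"
    unfolding skew_one using finite_mor objects_subset_mor
    by (intro sum.mono_neutral_cong_right) auto
  show "(\<Oplus>\<^bsub>S\<^esub>g\<in>mor G. skew_embedding G D (trace (dual_left g)) \<otimes>\<^bsub>S\<^esub> dual_right g) = \<one>\<^bsub>S\<^esub>"
    unfolding one[symmetric] using embedding_mem dual_left_mem dual_right_mem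
    by (subst skew_finsum[OF finite_mor]) (auto intro!: sum.cong simp: left delta_mem idem_mem zero_mem)
  show "(\<Oplus>\<^bsub>S\<^esub>g\<in>mor G. dual_left g \<otimes>\<^bsub>S\<^esub> skew_embedding G D (trace (dual_right g))) = \<one>\<^bsub>S\<^esub>"
    unfolding one[symmetric] using embedding_mem dual_left_mem dual_right_mem
    by (subst skew_finsum[OF finite_mor]) (auto intro!: sum.cong simp: right delta_mem idem_mem zero_mem)
qed

end

theorem theorem5p10:
  fixes G :: "('g, 'm) category_data_scheme"
    and D :: "'g \<Rightarrow> 'a::ring set"
    and \<alpha> :: "'g \<Rightarrow> 'a \<Rightarrow> 'a"
  assumes "connected_groupoid G"
    and "finite (objects G)"
    and "unital_partial_action G D \<alpha>"
    and "group_type G D"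
    and "is_direct_sum (objects G) D"
    and "finite (mor G)"
  shows "frobenius_extension (base_ring G D) (skew_groupoid_ring G D \<alpha>) (skew_embedding G D)"
proof -
  interpret unital_partial_action_direct_sum G D \<alpha>
    using assms
    by (simp add: unital_partial_action_direct_sum_def finite_unital_partial_action_def
        unital_partial_action_direct_sum_axioms_def finite_unital_partial_action_axioms_def)
  show ?thesis by (rule frobenius)
qed

end
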